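(* Let $p$ be an odd prime, let $n\ge 3$ be an integer, and let $m=n+5$. Then there exists a $4$-generated group $G$ of order $p^m$ and exponent $p^n$ such that $\operatorname{Aut}(G)$ is abelian, but $G$ is not special. Moreover, $|\operatorname{Aut}(G)|=p^{n+10}$.
   Context: $\operatorname{Aut}(G)$ is the group of all automorphisms of $G$. A finite $p$-group $G$ is special if it is non-abelian and its center, commutator subgroup and Frattini subgroup coincide and are elementary abelian (in the usual sense). The "moreover" clause refers to the same group $G$ whose existence is asserted. *)

theory Defs
  imports "HOL-Algebra.Algebra" "HOL-Computational_Algebra.Primes"
begin

definition finite_p_group :: "nat \<Rightarrow> ('a, 'b) monoid_scheme \<Rightarrow> bool" where
  "finite_p_group p G \<longleftrightarrow> Factorial_Ring.prime p \<and> group G \<and> (\<exists>k. order G = p ^ k)"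

definition center :: "('a, 'b) monoid_scheme \<Rightarrow> 'a set" where
  "center G = {z \<in> carrier G. \<forall>x \<in> carrier G. z \<otimes>\<^bsub>G\<^esub> x = x \<otimes>\<^bsub>G\<^esub> z}"

definition maximal_subgroup :: "'a set \<Rightarrow> ('a, 'b) monoid_scheme \<Rightarrow> bool" where
  "maximal_subgroup M G \<longleftrightarrow>
     subgroup M G \<and> M \<noteq> carrier G \<and>
     (\<forall>H. subgroup H G \<longrightarrow> M \<subseteq> H \<longrightarrow> H = M \<or> H = carrier G)"

(* Intersecting with the carrier makes this the whole group when there are no maximal subgroups. *)
definition frattini :: "('a, 'b) monoid_scheme \<Rightarrow> 'a set" where
  "frattini G = carrier G \<inter> \<Inter>{M. maximal_subgroup M G}"

definition elementary_abelian :: "nat \<Rightarrow> ('a, 'b) monoid_scheme \<Rightarrow> bool" where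
  "elementary_abelian p E \<longleftrightarrow>
     comm_group E \<and> (\<forall>x \<in> carrier E. x [^]\<^bsub>E\<^esub> p = \<one>\<^bsub>E\<^esub>)"

definition special_p_group :: "nat \<Rightarrow> ('a, 'b) monoid_scheme \<Rightarrow> bool" where
  "special_p_group p G \<longleftrightarrow>
     finite_p_group p G \<and> \<not> comm_group G \<and>
     center G = derived G (carrier G) \<and>
     derived G (carrier G) = frattini G \<and>
     elementary_abelian p (G\<lparr>carrier := center G\<rparr>)"

(* Intended for finite groups, where the set of admissible exponents is nonempty. *)
definition group_exponent :: "('a, 'b) monoid_scheme \<Rightarrow> nat" where
  "group_exponent G = (LEAST e. 0 < e \<and> (\<forall>x \<in> carrier G. x [^]\<^bsub>G\<^esub> e = \<one>\<^bsub>G\<^esub>))"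

(* The minimal number of generators is exactly d, as usual for p-groups. *)
definition d_generated :: "nat \<Rightarrow> ('a, 'b) monoid_scheme \<Rightarrow> bool" where
  "d_generated d G \<longleftrightarrow>
     (\<exists>S \<subseteq> carrier G. finite S \<and> card S = d \<and> generate G S = carrier G) \<and>
     (\<forall>S \<subseteq> carrier G. finite S \<longrightarrow> generate G S = carrier G \<longrightarrow> d \<le> card S)"

end

theory Submission
  imports Defs
begin

text \<open>Put \<open>q = p^(n - 1)\<close>. The group is generated by \<open>x1, x2, x3, x4\<close> of orders
\<open>p^n, p^2, p^2, p\<close>, is nilpotent of class 2, and satisfies
\<open>[x1,x3] = [x1,x4] = x3^p\<close>, \<open>[x2,x3] = x1^q\<close>, \<open>[x2,x4] = x2^p\<close>, \<open>[x1,x2] = [x3,x4] = 1\<close>,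
where \<open>[u,v]\<close> is the element with \<open>u v = v u [u,v]\<close>. Its derived subgroup is elementary abelian of
rank 3, spanned by \<open>x1^q, x2^p, x3^p\<close>, and its centre is spanned by \<open>x1^p, x2^p, x3^p\<close>. The
element \<open>x1^p\<close> has order \<open>q > p\<close> because \<open>n \<ge> 3\<close>, so the group is not special.

The relations are chosen so that they leave no room modulo the centre: every automorphism is
congruent to the identity there (lemma \<open>auto_congruences\<close>). Power relations tie the action on the
derived subgroup to the action on generators modulo \<open>p\<close>, because for odd \<open>p\<close>, class 2 and derived
subgroup of exponent \<open>p\<close>, the \<open>p\<close>-th power map is a homomorphism. Each commutator relation then becomes a congruence between the
matrix entries of the automorphism. For instance \<open>[x2,x4] = x2^p\<close> forces the coefficient of \<open>x4\<close>
in the image of \<open>x4\<close> to be 1. Together with injectivity and the order of \<open>x4\<close>,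
the six relations determine all sixteen entries.

An automorphism that is trivial modulo the centre multiplies each generator by a central element.
It fixes the derived subgroup, which contains the \<open>p\<close>-th powers of \<open>x2, x3, x4\<close>, so for these three
generators the central factor has order dividing \<open>p\<close> and lies in the derived subgroup. For \<open>x1\<close>
every central factor is possible. This gives
\<open>p^(n + 1) * (p^3)^3 = p^(n + 10)\<close> automorphisms (lemma \<open>auto_eq_central\<close>). Two of
them commute: a composite sends \<open>u\<close> to \<open>u\<close> times both central factors times a correction, and the
correction is the action of one automorphism on the factor produced by the other. Derived factors
contribute nothing to it, so only the \<open>x1\<close>-exponent matters, where the contribution is the symmetric
product \<open>p^2 * s * s'\<close> (lemma \<open>red_central_commute\<close>).

At least four generators are needed because the group maps onto the elementary abelian group of
rank 4, and a subgroup of such a group generated by \<open>k\<close> elements has at most \<open>p^k\<close> elements.\<close>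

section \<open>Invariance under isomorphism\<close>

lemma exists_iso_nat_group:
  fixes H :: "('a, 'b) monoid_scheme"
  assumes "group H" "finite (carrier H)"
  shows "\<exists>(G :: nat monoid) f. group G \<and> f \<in> iso H G"
proof -
  interpret H: group H by fact
  obtain h where h: "bij_betw h (carrier H) {0..<card (carrier H)}"
    using ex_bij_betw_finite_nat[OF assms(2)] by blast
  define g where "g = inv_into (carrier H) h"
  define G :: "nat monoid" where
    "G = \<lparr>carrier = {0..<card (carrier H)}, monoid.mult = \<lambda>x y. h (g x \<otimes>\<^bsub>H\<^esub> g y), one = h \<one>\<^bsub>H\<^esub>\<rparr>"
  have gh: "g (h x) = x" if "x \<in> carrier H" for x
    using h that by (simp add: g_def bij_betw_def)
  have f: "h \<in> iso H G"
    using h by (auto simp: iso_def hom_def G_def gh bij_betw_def)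
  then have "group (G\<lparr>one := h \<one>\<^bsub>H\<^esub>\<rparr>)"
    by (rule H.iso_imp_img_group)
  then have "group G" by (simp add: G_def)
  with f show ?thesis by blast
qed

context
  fixes G :: "('a, 'c) monoid_scheme" and H :: "('b, 'd) monoid_scheme" and f
  assumes G: "group G" and H: "group H" and f: "f \<in> iso G H"
begin

lemma iso_pow_eq_one_iff:
  assumes "x \<in> carrier G"
  shows "f x [^]\<^bsub>H\<^esub> (e::nat) = \<one>\<^bsub>H\<^esub> \<longleftrightarrow> x [^]\<^bsub>G\<^esub> e = \<one>\<^bsub>G\<^esub>"
proof -
  interpret f: group_hom G H f
    using G H f by (simp add: group_hom_def group_hom_axioms_def iso_def)
  have "inj_on f (carrier G)" using f by (simp add: iso_def bij_betw_def)
  then show ?thesis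
    using assms by (metis f.G.nat_pow_closed f.G.one_closed f.hom_nat_pow f.hom_one inj_on_eq_iff)
qed

lemma iso_image_carrier: "f ` carrier G = carrier H"
  using f by (simp add: iso_def bij_betw_def)

lemma iso_group_exponent: "group_exponent H = group_exponent G"
  unfolding group_exponent_def iso_image_carrier[symmetric]
  by (simp add: iso_pow_eq_one_iff)

lemma iso_d_generated:
  assumes "d_generated d G"
  shows "d_generated d H"
proof -
  interpret f: group_hom G H f
    using G H f by (simp add: group_hom_def group_hom_axioms_def iso_def)
  have inj: "inj_on f (carrier G)" using f by (simp add: iso_def bij_betw_def)
  obtain S where S: "S \<subseteq> carrier G" "finite S" "card S = d" "generate G S = carrier G"
    using assms unfolding d_generated_def by blast
  \<comment> \<open>The generating sets of the two groups correspond under the isomorphism, so both halves transfer.\<close>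
  have "\<exists>S\<subseteq>carrier H. finite S \<and> card S = d \<and> generate H S = carrier H"
    using S inj iso_image_carrier f.generate_img[OF S(1)]
    by (intro exI[of _ "f ` S"]) (auto simp: card_image inj_on_subset)
  moreover have "d \<le> card T"
    if T: "T \<subseteq> carrier H" "finite T" "generate H T = carrier H" for T
  proof -
    obtain U where U: "U \<subseteq> carrier G" "T = f ` U" "inj_on f U"
      using T(1) iso_image_carrier subset_image_inj by metis
    have "f ` generate G U = f ` carrier G"
      using U T(3) f.generate_img[OF U(1)] iso_image_carrier by simp
    then have "generate G U = carrier G"
      using inj f.G.generate_incl[OF U(1)] by (meson inj_on_image_eq_iff order_refl)
    moreover have "finite U" using U T(2) finite_imageD by metis
    ultimately have "d \<le> card U"
      using assms U(1) unfolding d_generated_def by blast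
    then show ?thesis using U by (simp add: card_image)
  qed
  ultimately show ?thesis unfolding d_generated_def by blast
qed

lemma iso_image_center:
  assumes "z \<in> center G"
  shows "f z \<in> center H"
  using assms f unfolding center_def iso_image_carrier[symmetric]
  by (auto simp: iso_def hom_def) metis

lemma conj_auto:
  assumes \<phi>: "\<phi> \<in> auto G"
  shows "(\<lambda>y\<in>carrier H. f (\<phi> (inv_into (carrier G) f y))) \<in> auto H"
proof -
  let ?g = "inv_into (carrier G) f"
  have g: "?g \<in> iso H G" using group.iso_set_sym[OF G f] .
  have "\<phi> \<in> iso G G" using \<phi> by (simp add: auto_def iso_def Bij_def)
  then have "f \<circ> (\<phi> \<circ> ?g) \<in> iso H H"
    by (rule iso_set_trans[OF iso_set_trans[OF g] f])
  then have *: "f \<circ> (\<phi> \<circ> ?g) \<in> hom H H" "bij_betw (f \<circ> (\<phi> \<circ> ?g)) (carrier H) (carrier H)"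
    by (auto simp: iso_def)
  have "bij_betw (\<lambda>y\<in>carrier H. f (\<phi> (?g y))) (carrier H) (carrier H)"
    using *(2) by (subst bij_betw_cong[where g = "f \<circ> (\<phi> \<circ> ?g)"]) auto
  moreover have "(\<lambda>y\<in>carrier H. f (\<phi> (?g y))) \<in> hom H H"
    using *(1) H by (auto simp: hom_def Pi_iff group.is_monoid monoid.m_closed)
  ultimately show ?thesis by (simp add: auto_def Bij_def)
qed

end

lemma AutoGroup_simps:
  "carrier (AutoGroup G) = auto G"
  "\<phi> \<in> auto G \<Longrightarrow> \<psi> \<in> auto G \<Longrightarrow> \<phi> \<otimes>\<^bsub>AutoGroup G\<^esub> \<psi> = compose (carrier G) \<phi> \<psi>"
  by (auto simp: AutoGroup_def BijGroup_def auto_def)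

text \<open>Conjugation by the isomorphism carries automorphisms to automorphisms. All maps are cut down to the
carriers because elements of the automorphism group are extensional functions.\<close>

lemma iso_AutoGroup:
  assumes G: "group G" and H: "group H" and f: "f \<in> iso G H"
  shows "AutoGroup G \<cong> AutoGroup H"
proof -
  let ?g = "inv_into (carrier G) f"
  define F where "F \<phi> = (\<lambda>y\<in>carrier H. f (\<phi> (?g y)))" for \<phi>
  define F' where "F' \<psi> = (\<lambda>x\<in>carrier G. ?g (\<psi> (f x)))" for \<psi>
  have bij: "bij_betw f (carrier G) (carrier H)" using f by (simp add: iso_def)
  have g: "?g \<in> iso H G" using group.iso_set_sym[OF G f] .
  have gf: "?g (f x) = x" if "x \<in> carrier G" for x
    using bij that by (simp add: bij_betw_def)
  have fg: "f (?g y) = y" if "y \<in> carrier H" for y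
    using bij that by (simp add: bij_betw_inv_into_right)
  have fc: "f x \<in> carrier H" if "x \<in> carrier G" for x
    using bij that by (auto simp: bij_betw_def)
  have gc: "?g y \<in> carrier G" if "y \<in> carrier H" for y
    using g that by (auto simp: iso_def hom_def)
  have F: "F \<phi> \<in> auto H" if "\<phi> \<in> auto G" for \<phi>
    using conj_auto[OF G H f that] by (simp add: F_def)
  have gg: "inv_into (carrier H) ?g x = f x" if "x \<in> carrier G" for x
    using that bij by (simp add: inv_into_inv_into_eq)
  have F': "F' \<psi> \<in> auto G" if "\<psi> \<in> auto H" for \<psi>
    using conj_auto[OF H G g that] by (simp add: F'_def gg cong: restrict_cong)
  have ext: "\<phi> \<in> extensional (carrier K)" "\<And>x. x \<in> carrier K \<Longrightarrow> \<phi> x \<in> carrier K"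
    if "\<phi> \<in> auto K" for \<phi> and K :: "('x,'y) monoid_scheme"
    using that by (auto simp: auto_def Bij_def bij_betw_def)
  have FF': "F' (F \<phi>) = \<phi>" if "\<phi> \<in> auto G" for \<phi>
    using ext[OF that] by (intro extensionalityI[of _ "carrier G"]) (auto simp: F_def F'_def fc gf)
  have F'F: "F (F' \<psi>) = \<psi>" if "\<psi> \<in> auto H" for \<psi>
    using ext[OF that] by (intro extensionalityI[of _ "carrier H"]) (auto simp: F_def F'_def gc fg)
  have "bij_betw F (auto G) (auto H)"
    using F F' FF' F'F by (intro bij_betw_byWitness[of _ F']) auto
  moreover have "F (compose (carrier G) \<phi> \<psi>) = compose (carrier H) (F \<phi>) (F \<psi>)"
    if "\<phi> \<in> auto G" "\<psi> \<in> auto G" for \<phi> \<psi>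
    using ext[OF that(1)] ext[OF that(2)]
    by (intro extensionalityI[of _ "carrier H"]) (auto simp: F_def compose_def gc gf fc)
  ultimately have "F \<in> iso (AutoGroup G) (AutoGroup H)"
    using F group.AutoGroup[OF G]
    by (intro isoI homI) (auto simp: AutoGroup_simps)
  then show ?thesis by (auto simp: is_iso_def)
qed

section \<open>Generating elementary abelian groups\<close>

text \<open>Adding a generator \<open>x\<close> to a subgroup \<open>K\<close> enlarges it at most \<open>p\<close>-fold, since the products
\<open>x^i h\<close> with \<open>i < p\<close> and \<open>h \<in> K\<close> already form a subgroup when \<open>x^p = \<one>\<close>.\<close>

lemma (in comm_group) card_generate_le:
  assumes p: "p > 0" and exp: "\<And>x. x \<in> carrier G \<Longrightarrow> x [^] (p::nat) = \<one>"
    and "finite S" "S \<subseteq> carrier G"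
  shows "finite (generate G S) \<and> card (generate G S) \<le> p ^ card S"
  using \<open>finite S\<close> \<open>S \<subseteq> carrier G\<close>
proof (induction S rule: finite_induct)
  case empty
  then show ?case by (simp add: generate_empty)
next
  case (insert x S)
  define K where "K = generate G S"
  have x: "x \<in> carrier G" and S: "S \<subseteq> carrier G" using insert.prems by auto
  interpret K: subgroup K G unfolding K_def using generate_is_subgroup[OF S] .
  have K: "finite K" "card K \<le> p ^ card S" using insert.IH[OF S] by (auto simp: K_def)
  define f where "f = (\<lambda>(i::nat, h). x [^] i \<otimes> h)"
  define L where "L = f ` ({..<p} \<times> K)"
  have pow_mod: "x [^] (i::nat) = x [^] (i mod p)" for i
  proof -
    have "x [^] i = x [^] (p * (i div p)) \<otimes> x [^] (i mod p)"
      using x by (simp add: nat_pow_mult)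
    also have "x [^] (p * (i div p)) = \<one>"
      using nat_pow_pow[OF x, of p "i div p"] exp[OF x] by simp
    finally show ?thesis using x by simp
  qed
  have inL: "x [^] (i::nat) \<otimes> h \<in> L" if "h \<in> K" for i h
    unfolding L_def f_def using that p pow_mod[of i, symmetric]
    by (intro image_eqI[of _ _ "(i mod p, h)"]) auto
  have powL: "x [^] (i::nat) \<in> L" for i
    using inL[of \<one> i] x by simp
  have LI: "\<exists>(i::nat) h. h \<in> K \<and> y = x [^] i \<otimes> h" if "y \<in> L" for y
    using that by (auto simp: L_def f_def)
  have "generate G (insert x S) \<subseteq> L"
  proof
    fix y assume "y \<in> generate G (insert x S)"
    then show "y \<in> L"
    proof (induction rule: generate.induct)
      case one
      show ?case using inL[of \<one> 0] by simp
    next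
      case (incl h)
      then show ?case
        using powL[of 1] inL[of h 0] x S by (auto simp: K_def generate.incl)
    next
      case (inv h)
      have "inv h = h [^] (p - 1)" if "h \<in> carrier G"
        using exp[OF that] that p
        by (intro inv_equality) (simp_all add: nat_pow_Suc[symmetric] del: nat_pow_Suc)
      with inv show ?case
        using powL[of "p - 1"] inL[of "inv h" 0] x S by (auto simp: K_def generate.inv subset_iff)
    next
      case (eng h1 h2)
      obtain i1 :: nat and k1 where 1: "k1 \<in> K" "h1 = x [^] i1 \<otimes> k1" using LI eng by blast
      obtain i2 :: nat and k2 where 2: "k2 \<in> K" "h2 = x [^] i2 \<otimes> k2" using LI eng by blast
      have "h1 \<otimes> h2 = x [^] (i1 + i2) \<otimes> (k1 \<otimes> k2)"
        using 1 2 x by (simp add: m_ac nat_pow_mult[symmetric])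
      then show ?case using inL[of "k1 \<otimes> k2" "i1 + i2"] 1 2 by simp
    qed
  qed
  moreover have "finite L" "card L \<le> p * card K"
    using K card_image_le[of "{..<p} \<times> K" f] by (auto simp: L_def card_cartesian_product)
  ultimately have fin: "finite (generate G (insert x S))"
    and "card (generate G (insert x S)) \<le> p * card K"
    by (auto intro: finite_subset order_trans[OF card_mono])
  note this(2)
  also have "p * card K \<le> p * p ^ card S" using K(2) by simp
  finally show ?case using fin insert.hyps by simp
qed

section \<open>A criterion for not being special\<close>

lemma (in group) not_special_p_group:
  assumes "z \<in> center G" "z [^] p \<noteq> \<one>"
  shows "\<not> special_p_group p G"
proof -
  have "z [^]\<^bsub>G\<lparr>carrier := center G\<rparr>\<^esub> p = z [^] p"
    by (simp add: nat_pow_def)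
  then show ?thesis
    using assms unfolding special_p_group_def elementary_abelian_def by auto
qed

section \<open>The group\<close>

lemma odd_dvd_choose_two:
  fixes k :: nat
  assumes "odd m" "m dvd k"
  shows "m dvd k choose 2"
proof -
  have "2 * (k choose 2) = k * (k - 1)"
    unfolding choose_two by (rule dvd_mult_div_cancel) (cases k; simp)
  then have "m dvd 2 * (k choose 2)" using assms(2) by simp
  then show ?thesis using assms(1) by (simp add: coprime_dvd_mult_right_iff)
qed

type_synonym quad = "int \<times> int \<times> int \<times> int"

locale odd_prime_ge3 =
  fixes p :: int and n :: nat
  assumes prime_p: "Factorial_Ring.prime p" and odd_p: "odd p" and n3: "3 \<le> n"
begin

definition q :: int where "q = p ^ (n - 1)"

lemma p_gt_1: "p > 1" using prime_p prime_gt_1_int by blast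

lemma q_pos: "q > 0" using p_gt_1 by (simp add: q_def)

lemma p_pow_n: "p ^ n = p * q"
  using n3 by (simp add: q_def flip: power_Suc)

lemma q_eq: obtains r where "q = p * p * r"
proof -
  obtain m where "n = 3 + m" using n3 le_Suc_ex by blast
  then have "q = p * p * p ^ m" unfolding q_def by (simp add: eval_nat_numeral)
  then show ?thesis by (rule that)
qed

fun red :: "quad \<Rightarrow> quad" where
  "red (a, b, c, d) = (a mod (p * q), b mod (p * p), c mod (p * p), d mod p)"

text \<open>The quadruple \<open>(a, b, c, d)\<close> stands for \<open>x3^c x4^d x2^b x1^a\<close>. The terms \<open>q b c'\<close>, \<open>p b d'\<close> and
\<open>p a (c' + d')\<close> form a bilinear 2-cocycle with values in the derived subgroup. Only its
skew part matters for commutators, and this representative is the one that vanishes whenever the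
left factor is ordered before the right one in the product above. It is computed over the integers,
and depends only on the coordinates modulo \<open>p\<close>, because \<open>p q\<close> is zero in the first coordinate and
\<open>p p\<close> in the second and third.\<close>

fun mul :: "quad \<Rightarrow> quad \<Rightarrow> quad" where
  "mul (a, b, c, d) (a', b', c', d') =
     (a + a' + q * b * c', b + b' + p * b * d', c + c' + p * a * (c' + d'), d + d')"

definition \<Gamma> :: "quad monoid" where
  "\<Gamma> = \<lparr>carrier = {0..<p * q} \<times> {0..<p * p} \<times> {0..<p * p} \<times> {0..<p},
        monoid.mult = \<lambda>u v. red (mul u v), one = (0, 0, 0, 0)\<rparr>"

lemma red_eq_iff:
  "red (a, b, c, d) = red (a', b', c', d') \<longleftrightarrow>
     p * q dvd a - a' \<and> p * p dvd b - b' \<and> p * p dvd c - c' \<and> p dvd d - d'"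
  by (simp add: mod_eq_dvd_iff)

lemma red_eqI:
  assumes "a - a' = p * q * ka" "b - b' = p * p * kb" "c - c' = p * p * kc" "d - d' = p * kd"
  shows "red (a, b, c, d) = red (a', b', c', d')"
  unfolding red_eq_iff assms by simp

declare red.simps [simp del]

lemma red_closed: "red u \<in> carrier \<Gamma>"
  using p_gt_1 q_pos by (cases u) (simp add: \<Gamma>_def red.simps)

lemma red_id: "u \<in> carrier \<Gamma> \<Longrightarrow> red u = u"
  by (cases u) (simp add: \<Gamma>_def red.simps)

lemma carrier_cases:
  assumes "u \<in> carrier \<Gamma>"
  obtains a b c d where "u = red (a, b, c, d)"
  using red_id[OF assms] by (metis prod_cases4)

lemma one_eq: "\<one>\<^bsub>\<Gamma>\<^esub> = red (0, 0, 0, 0)"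
  by (simp add: \<Gamma>_def red.simps)

lemma red_eqE:
  assumes "red (a, b, c, d) = red (a', b', c', d')"
  obtains ka kb kc kd
  where "a = a' + p * q * ka" "b = b' + p * p * kb" "c = c' + p * p * kc" "d = d' + p * kd"
proof -
  have "\<exists>k. x = y + m * k" if "m dvd x - y" for x y m :: int
    using that by (metis add.commute diff_add_cancel dvd_def)
  then show ?thesis using assms that unfolding red_eq_iff by metis
qed

lemma red_mul_cong:
  assumes "red u = red u'" "red v = red v'"
  shows "red (mul u v) = red (mul u' v')"
proof -
  obtain a b c d where u: "u = (a, b, c, d)" by (cases u)
  obtain a' b' c' d' where u': "u' = (a', b', c', d')" by (cases u')
  obtain e f g h where v: "v = (e, f, g, h)" by (cases v)
  obtain e' f' g' h' where v': "v' = (e', f', g', h')" by (cases v')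
  obtain ka kb kc kd
    where k: "a = a' + p * q * ka" "b = b' + p * p * kb" "c = c' + p * p * kc" "d = d' + p * kd"
    using assms(1) unfolding u u' by (rule red_eqE)
  obtain ke kf kg kh
    where l: "e = e' + p * q * ke" "f = f' + p * p * kf" "g = g' + p * p * kg" "h = h' + p * kh"
    using assms(2) unfolding v v' by (rule red_eqE)
  have "(a + e + q * b * g) - (a' + e' + q * b' * g') = p * q * (ka + ke + p * b' * kg + p * kb * g)"
    by (simp add: k l algebra_simps)
  moreover have "(b + f + p * b * h) - (b' + f' + p * b' * h') = p * p * (kb + kf + p * kb * h + b' * kh)"
    by (simp add: k l algebra_simps)
  moreover have "(c + g + p * a * (g + h)) - (c' + g' + p * a' * (g' + h')) =
      p * p * (kc + kg + q * ka * (g + h) + a' * (p * kg + kh))"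
    by (simp add: k l algebra_simps)
  moreover have "(d + h) - (d' + h') = p * (kd + kh)"
    by (simp add: k l algebra_simps)
  ultimately show ?thesis
    unfolding u u' v v' mul.simps red_eq_iff by (intro conjI) (metis dvd_triv_left)+
qed

lemma red_red [simp]: "red (red u) = red u"
  by (rule red_id[OF red_closed])

lemma mult_red: "red u \<otimes>\<^bsub>\<Gamma>\<^esub> red v = red (mul u v)"
  using red_mul_cong[of "red u" u "red v" v] by (simp add: \<Gamma>_def)

lemma group_\<Gamma>: "group \<Gamma>"
proof (rule groupI)
  obtain r where r: "q = p * p * r" by (rule q_eq)
  fix x assume "x \<in> carrier \<Gamma>"
  then obtain a b c d where x: "x = red (a, b, c, d)" by (rule carrier_cases)
  show "\<one>\<^bsub>\<Gamma>\<^esub> \<otimes>\<^bsub>\<Gamma>\<^esub> x = x" by (simp add: x one_eq mult_red)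
  have "red (mul (- a + q * b * c, - b + p * b * d, - c + p * a * (c + d), - d) (a, b, c, d)) = red (0, 0, 0, 0)"
  proof -
    \<comment> \<open>The inverse corrects the negated coordinates by the cocycle; what remains are the terms of degree 3.\<close>
    have "q * b * c + q * (- b + p * b * d) * c = p * q * (b * c * d)"
      "p * b * d + p * (- b + p * b * d) * d = p * p * (b * d * d)"
      "p * a * (c + d) + p * (- a + q * b * c) * (c + d) = p * p * (p * r * b * c * (c + d))"
      by (simp_all add: r algebra_simps)
    then show ?thesis unfolding mul.simps red_eq_iff by (simp add: algebra_simps)
  qed
  then show "\<exists>y\<in>carrier \<Gamma>. y \<otimes>\<^bsub>\<Gamma>\<^esub> x = \<one>\<^bsub>\<Gamma>\<^esub>"
    unfolding x one_eq by (metis mult_red red_closed)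
  fix y assume "y \<in> carrier \<Gamma>"
  then obtain a' b' c' d' where y: "y = red (a', b', c', d')" by (rule carrier_cases)
  show "x \<otimes>\<^bsub>\<Gamma>\<^esub> y \<in> carrier \<Gamma>" using red_closed by (simp add: x y mult_red)
  fix z assume "z \<in> carrier \<Gamma>"
  then obtain a'' b'' c'' d'' where z: "z = red (a'', b'', c'', d'')" by (rule carrier_cases)
  have "red (mul (mul (a, b, c, d) (a', b', c', d')) (a'', b'', c'', d'')) =
        red (mul (a, b, c, d) (mul (a', b', c', d') (a'', b'', c'', d'')))"
    unfolding mul.simps red_eq_iff
  proof (intro conjI)
    show "p * q dvd a + a' + q * b * c' + a'' + q * (b + b' + p * b * d') * c'' -
        (a + (a' + a'' + q * b' * c'') + q * b * (c' + c'' + p * a' * (c'' + d'')))"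
      by (rule dvdI[where k = "b * d' * c'' - b * a' * (c'' + d'')"]) (simp add: algebra_simps)
    show "p * p dvd b + b' + p * b * d' + b'' + p * (b + b' + p * b * d') * d'' -
        (b + (b' + b'' + p * b' * d'') + p * b * (d' + d''))"
      by (rule dvdI[where k = "b * d' * d''"]) (simp add: algebra_simps)
    show "p * p dvd c + c' + p * a * (c' + d') + c'' + p * (a + a' + q * b * c') * (c'' + d'') -
        (c + (c' + c'' + p * a' * (c'' + d'')) + p * a * (c' + c'' + p * a' * (c'' + d'') + (d' + d'')))"
      by (rule dvdI[where k = "p * r * b * c' * (c'' + d'') - a * a' * (c'' + d'')"])
        (simp add: r algebra_simps)
  qed simp
  then show "x \<otimes>\<^bsub>\<Gamma>\<^esub> y \<otimes>\<^bsub>\<Gamma>\<^esub> z = x \<otimes>\<^bsub>\<Gamma>\<^esub> (y \<otimes>\<^bsub>\<Gamma>\<^esub> z)"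
    by (simp add: x y z mult_red)
qed (use red_closed in \<open>simp add: one_eq\<close>)

sublocale \<Gamma>: group \<Gamma> by (rule group_\<Gamma>)

lemma order_\<Gamma>: "order \<Gamma> = nat p ^ (n + 5)"
proof -
  have "nat q = nat p ^ (n - 1)"
    using p_gt_1 by (simp add: q_def nat_power_eq)
  then have "card (carrier \<Gamma>) = nat p * nat p ^ (n - 1) * (nat p * nat p) * (nat p * nat p) * nat p"
    using p_gt_1 q_pos by (simp add: \<Gamma>_def card_cartesian_product nat_mult_distrib)
  also have "\<dots> = nat p ^ Suc (n - 1) * nat p ^ 5" by (simp add: numeral_eq_Suc)
  finally show ?thesis using n3 by (simp add: order_def power_add)
qed

text \<open>The cocycle is evaluated at the pairs of factors in \<open>u^k\<close>, which is where the binomial coefficient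
comes from.\<close>

lemma pow_red:
  "red (a, b, c, d) [^]\<^bsub>\<Gamma>\<^esub> (k::nat) =
     red (int k * a + q * int (k choose 2) * b * c, int k * b + p * int (k choose 2) * b * d,
          int k * c + p * int (k choose 2) * a * (c + d), int k * d)"
proof (induction k)
  case 0
  show ?case by (simp add: one_eq binomial_eq_0)
next
  case (Suc k)
  obtain r where r: "q = p * p * r" by (rule q_eq)
  define C where "C = int (k choose 2)"
  have C: "int (Suc k choose 2) = C + int k"
    by (simp add: C_def numeral_2_eq_2)
  have "red (mul (int k * a + q * C * b * c, int k * b + p * C * b * d,
        int k * c + p * C * a * (c + d), int k * d) (a, b, c, d)) =
     red (int (Suc k) * a + q * (C + int k) * b * c, int (Suc k) * b + p * (C + int k) * b * d,
          int (Suc k) * c + p * (C + int k) * a * (c + d), int (Suc k) * d)"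
    unfolding mul.simps red_eq_iff
  proof (intro conjI)
    show "p * q dvd int k * a + q * C * b * c + a + q * (int k * b + p * C * b * d) * c -
        (int (Suc k) * a + q * (C + int k) * b * c)"
      by (rule dvdI[where k = "C * b * c * d"]) (simp add: algebra_simps)
    show "p * p dvd int k * b + p * C * b * d + b + p * (int k * b + p * C * b * d) * d -
        (int (Suc k) * b + p * (C + int k) * b * d)"
      by (rule dvdI[where k = "C * b * d * d"]) (simp add: algebra_simps)
    show "p * p dvd int k * c + p * C * a * (c + d) + c + p * (int k * a + q * C * b * c) * (c + d) -
        (int (Suc k) * c + p * (C + int k) * a * (c + d))"
      by (rule dvdI[where k = "p * r * C * b * c * (c + d)"]) (simp add: r algebra_simps)
  qed (simp add: algebra_simps)
  then show ?case
    by (simp add: Suc.IH mult_red C C_def[symmetric] del: of_nat_Suc)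
qed

text \<open>This is where odd \<open>p\<close> is used: \<open>k choose 2\<close> is again a multiple of \<open>p\<close>, so the cocycle terms vanish and
the power map is linear in the coordinates.\<close>

lemma pow_red_multiple:
  assumes "p dvd int k"
  shows "red (a, b, c, d) [^]\<^bsub>\<Gamma>\<^esub> k = red (int k * a, int k * b, int k * c, 0)"
proof -
  have "nat p dvd k" "odd (nat p)"
    using assms p_gt_1 odd_p by (auto simp: nat_dvd_iff even_nat_iff)
  then have "nat p dvd k choose 2" by (rule odd_dvd_choose_two[rotated])
  then have "p dvd int (k choose 2)" using p_gt_1 by (simp add: nat_dvd_iff)
  then obtain m where m: "int (k choose 2) = p * m" by (elim dvdE)
  show ?thesis
    unfolding pow_red red_eq_iff m using assms by (simp add: mult.assoc mult.left_commute)
qed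

section \<open>Generators and normal form\<close>

definition x1 :: "quad" where "x1 = red (1, 0, 0, 0)"
definition x2 :: "quad" where "x2 = red (0, 1, 0, 0)"
definition x3 :: "quad" where "x3 = red (0, 0, 1, 0)"
definition x4 :: "quad" where "x4 = red (0, 0, 0, 1)"

lemma x_closed [simp]: "x1 \<in> carrier \<Gamma>" "x2 \<in> carrier \<Gamma>" "x3 \<in> carrier \<Gamma>" "x4 \<in> carrier \<Gamma>"
  by (simp_all add: x1_def x2_def x3_def x4_def red_closed)

text \<open>In this order of the factors the cocycle never contributes, so the exponents are the coordinates.\<close>

lemma normal_form:
  assumes "u \<in> carrier \<Gamma>"
  obtains i j k l :: nat
  where "u = x3 [^]\<^bsub>\<Gamma>\<^esub> k \<otimes>\<^bsub>\<Gamma>\<^esub> x4 [^]\<^bsub>\<Gamma>\<^esub> l \<otimes>\<^bsub>\<Gamma>\<^esub> x2 [^]\<^bsub>\<Gamma>\<^esub> j \<otimes>\<^bsub>\<Gamma>\<^esub> x1 [^]\<^bsub>\<Gamma>\<^esub> i"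
proof -
  obtain a b c d where u: "u = (a, b, c, d)" by (cases u)
  have "u = red (a, b, c, d)" using red_id[OF assms] u by simp
  moreover have "0 \<le> a" "0 \<le> b" "0 \<le> c" "0 \<le> d" using assms by (simp_all add: u \<Gamma>_def)
  ultimately show ?thesis
    by (intro that[where i = "nat a" and j = "nat b" and k = "nat c" and l = "nat d"])
      (simp add: x1_def x2_def x3_def x4_def pow_red mult_red)
qed

lemma generate_x: "generate \<Gamma> {x1, x2, x3, x4} = carrier \<Gamma>"
proof
  show "generate \<Gamma> {x1, x2, x3, x4} \<subseteq> carrier \<Gamma>"
    by (rule \<Gamma>.generate_incl) simp
  have pow: "x [^]\<^bsub>\<Gamma>\<^esub> (k::nat) \<in> generate \<Gamma> {x1, x2, x3, x4}" if "x \<in> {x1, x2, x3, x4}" for x k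
    using that by (induction k) (auto intro: generate.intros)
  show "carrier \<Gamma> \<subseteq> generate \<Gamma> {x1, x2, x3, x4}"
  proof
    fix u assume "u \<in> carrier \<Gamma>"
    then obtain i j k l :: nat where
      "u = x3 [^]\<^bsub>\<Gamma>\<^esub> k \<otimes>\<^bsub>\<Gamma>\<^esub> x4 [^]\<^bsub>\<Gamma>\<^esub> l \<otimes>\<^bsub>\<Gamma>\<^esub> x2 [^]\<^bsub>\<Gamma>\<^esub> j \<otimes>\<^bsub>\<Gamma>\<^esub> x1 [^]\<^bsub>\<Gamma>\<^esub> i"
      by (rule normal_form)
    then show "u \<in> generate \<Gamma> {x1, x2, x3, x4}"
      by (simp add: generate.eng pow)
  qed
qed

lemma hom_eqI:
  assumes "group H" "f \<in> hom \<Gamma> H" "g \<in> hom \<Gamma> H"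
    and "f x1 = g x1" "f x2 = g x2" "f x3 = g x3" "f x4 = g x4" "u \<in> carrier \<Gamma>"
  shows "f u = g u"
proof -
  interpret f: group_hom \<Gamma> H f using assms group_\<Gamma> by (simp add: group_hom_def group_hom_axioms_def)
  interpret g: group_hom \<Gamma> H g using assms group_\<Gamma> by (simp add: group_hom_def group_hom_axioms_def)
  obtain i j k l :: nat where
    "u = x3 [^]\<^bsub>\<Gamma>\<^esub> k \<otimes>\<^bsub>\<Gamma>\<^esub> x4 [^]\<^bsub>\<Gamma>\<^esub> l \<otimes>\<^bsub>\<Gamma>\<^esub> x2 [^]\<^bsub>\<Gamma>\<^esub> j \<otimes>\<^bsub>\<Gamma>\<^esub> x1 [^]\<^bsub>\<Gamma>\<^esub> i"
    using \<open>u \<in> carrier \<Gamma>\<close> by (rule normal_form)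
  then show ?thesis using assms(4-7) by (simp add: f.hom_nat_pow g.hom_nat_pow)
qed

section \<open>The minimal number of generators\<close>

text \<open>The quotient of \<open>\<Gamma>\<close> by its Frattini subgroup, a vector space of dimension 4 over the field with \<open>p\<close>
elements.\<close>

definition V :: "quad monoid" where
  "V = \<lparr>carrier = {0..<p} \<times> {0..<p} \<times> {0..<p} \<times> {0..<p},
     monoid.mult = \<lambda>(a, b, c, d) (a', b', c', d').
       ((a + a') mod p, (b + b') mod p, (c + c') mod p, (d + d') mod p),
     one = (0, 0, 0, 0)\<rparr>"

lemma comm_group_V: "comm_group V"
proof (rule comm_groupI)
  fix x assume "x \<in> carrier V"
  then obtain a b c d where "x = (a, b, c, d)" by (cases x)
  then show "\<exists>y\<in>carrier V. y \<otimes>\<^bsub>V\<^esub> x = \<one>\<^bsub>V\<^esub>"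
    using p_gt_1
    by (intro bexI[of _ "((- a) mod p, (- b) mod p, (- c) mod p, (- d) mod p)"])
      (auto simp: V_def mod_simps)
qed (use p_gt_1 in \<open>auto simp: V_def mod_simps algebra_simps\<close>)

lemma V_exponent:
  assumes "x \<in> carrier V"
  shows "x [^]\<^bsub>V\<^esub> nat p = \<one>\<^bsub>V\<^esub>"
proof -
  obtain a b c d where x: "x = (a, b, c, d)" by (cases x)
  have "x [^]\<^bsub>V\<^esub> k = ((int k * a) mod p, (int k * b) mod p, (int k * c) mod p, (int k * d) mod p)" for k :: nat
    by (induction k) (auto simp: V_def x nat_pow_def mod_simps algebra_simps)
  then show ?thesis using p_gt_1 by (simp add: V_def)
qed

definition to_V :: "quad \<Rightarrow> quad" where
  "to_V = (\<lambda>(a, b, c, d). (a mod p, b mod p, c mod p, d mod p))"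

lemma to_V_red: "to_V (red u) = to_V u"
  by (cases u) (simp add: to_V_def red.simps mod_mod_cancel)

lemma to_V_hom: "to_V \<in> hom \<Gamma> V"
proof (rule homI)
  obtain r where r: "q = p * (p * r)" using q_eq by (metis mult.assoc)
  fix x y assume "x \<in> carrier \<Gamma>" "y \<in> carrier \<Gamma>"
  obtain a b c d where x: "x = (a, b, c, d)" by (cases x)
  obtain a' b' c' d' where y: "y = (a', b', c', d')" by (cases y)
  have "to_V (mul x y) = to_V x \<otimes>\<^bsub>V\<^esub> to_V y"
    by (simp add: x y V_def to_V_def mod_simps r mult.assoc)
  then show "to_V (x \<otimes>\<^bsub>\<Gamma>\<^esub> y) = to_V x \<otimes>\<^bsub>V\<^esub> to_V y"
    by (simp add: \<Gamma>_def to_V_red)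
qed (use p_gt_1 in \<open>auto simp: to_V_def V_def\<close>)

lemma to_V_image: "to_V ` carrier \<Gamma> = carrier V"
proof
  show "to_V ` carrier \<Gamma> \<subseteq> carrier V" using to_V_hom by (auto simp: hom_def)
  show "carrier V \<subseteq> to_V ` carrier \<Gamma>"
  proof
    fix v assume "v \<in> carrier V"
    then have "v = to_V (red v)" unfolding to_V_red by (cases v) (simp add: V_def to_V_def)
    then show "v \<in> to_V ` carrier \<Gamma>" using red_closed by blast
  qed
qed

lemma card_generators_ge:
  assumes S: "S \<subseteq> carrier \<Gamma>" "finite S" "generate \<Gamma> S = carrier \<Gamma>"
  shows "4 \<le> card S"
proof -
  interpret V: comm_group V by (rule comm_group_V)
  interpret t: group_hom \<Gamma> V to_V
    using to_V_hom by unfold_locales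
  have "nat p ^ 4 = card (carrier V)"
    by (simp add: V_def card_cartesian_product numeral_eq_Suc)
  also have "carrier V = generate V (to_V ` S)"
    using t.generate_img[OF S(1)] S(3) to_V_image by simp
  also have "card \<dots> \<le> nat p ^ card (to_V ` S)"
    using V.card_generate_le[OF _ V_exponent, of "to_V ` S"] p_gt_1 S to_V_image by auto
  also have "\<dots> \<le> nat p ^ card S"
    using p_gt_1 card_image_le[OF S(2)] by (intro power_increasing) auto
  finally show ?thesis using p_gt_1 by (simp add: power_increasing_iff)
qed

lemma d_generated_\<Gamma>: "d_generated 4 \<Gamma>"
proof -
  have "p * q > 1" "p * p > 1"
    using p_gt_1 q_pos by (auto intro: less_1_mult simp: less_le_trans[of 1 p "p * q"])
  then have "card {x1, x2, x3, x4} = 4"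
    using p_gt_1 by (simp add: x1_def x2_def x3_def x4_def red.simps)
  then show ?thesis
    unfolding d_generated_def using generate_x card_generators_ge
    by (intro conjI exI[of _ "{x1, x2, x3, x4}"]) auto
qed

section \<open>Exponent and centre\<close>

lemma group_exponent_\<Gamma>: "group_exponent \<Gamma> = nat p ^ n"
  unfolding group_exponent_def
proof (rule Least_equality)
  have n: "int (nat p ^ n) = p * q" using p_gt_1 by (simp flip: p_pow_n)
  show "0 < nat p ^ n \<and> (\<forall>x\<in>carrier \<Gamma>. x [^]\<^bsub>\<Gamma>\<^esub> (nat p ^ n) = \<one>\<^bsub>\<Gamma>\<^esub>)"
  proof (intro conjI ballI)
    obtain r where r: "q = p * p * r" by (rule q_eq)
    fix x assume "x \<in> carrier \<Gamma>"
    then obtain a b c d where x: "x = red (a, b, c, d)" by (rule carrier_cases)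
    have "p dvd int (nat p ^ n)" unfolding n by simp
    then have "x [^]\<^bsub>\<Gamma>\<^esub> (nat p ^ n) = red (p * q * a, p * q * b, p * q * c, 0)"
      unfolding x by (subst pow_red_multiple) (auto simp only: n)
    also have "\<dots> = red (0, 0, 0, 0)" by (simp add: red_eq_iff) (simp add: r)
    finally show "x [^]\<^bsub>\<Gamma>\<^esub> (nat p ^ n) = \<one>\<^bsub>\<Gamma>\<^esub>" by (simp add: one_eq)
  qed (use p_gt_1 in simp)
  fix e :: nat assume e: "0 < e \<and> (\<forall>x\<in>carrier \<Gamma>. x [^]\<^bsub>\<Gamma>\<^esub> e = \<one>\<^bsub>\<Gamma>\<^esub>)"
  then have "x1 [^]\<^bsub>\<Gamma>\<^esub> e = \<one>\<^bsub>\<Gamma>\<^esub>" by simp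
  then have "int (nat p ^ n) dvd int e"
    by (simp only: n) (simp add: x1_def pow_red one_eq red_eq_iff)
  then show "nat p ^ n \<le> e" using e by (simp only: int_dvd_int_iff dvd_imp_le)
qed

text \<open>The centre is not elementary abelian; this is the point at which \<open>n \<ge> 3\<close> keeps the group from being
special.\<close>

lemma x1_pow_p:
  "x1 [^]\<^bsub>\<Gamma>\<^esub> nat p \<in> center \<Gamma>" "(x1 [^]\<^bsub>\<Gamma>\<^esub> nat p) [^]\<^bsub>\<Gamma>\<^esub> nat p \<noteq> \<one>\<^bsub>\<Gamma>\<^esub>"
proof -
  obtain r where r: "q = p * p * r" by (rule q_eq)
  have x: "x1 [^]\<^bsub>\<Gamma>\<^esub> nat p = red (p, 0, 0, 0)"
    unfolding x1_def using p_gt_1 by (simp add: pow_red)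
  have "red (p, 0, 0, 0) \<otimes>\<^bsub>\<Gamma>\<^esub> y = y \<otimes>\<^bsub>\<Gamma>\<^esub> red (p, 0, 0, 0)" if "y \<in> carrier \<Gamma>" for y
  proof -
    obtain a b c d where y: "y = red (a, b, c, d)" using carrier_cases[OF \<open>y \<in> carrier \<Gamma>\<close>] by blast
    show ?thesis by (simp add: y mult_red red_eq_iff)
  qed
  then show "x1 [^]\<^bsub>\<Gamma>\<^esub> nat p \<in> center \<Gamma>"
    by (simp add: x center_def red_closed)
  have "(x1 [^]\<^bsub>\<Gamma>\<^esub> nat p) [^]\<^bsub>\<Gamma>\<^esub> nat p = red (p * p, 0, 0, 0)"
    unfolding x using p_gt_1 by (simp add: pow_red)
  moreover have "\<not> p * q dvd p * p"
  proof
    assume "p * q dvd p * p"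
    then have "p * (p * r) dvd p * 1" using p_gt_1 by (simp add: r)
    then have "p * r dvd 1" using p_gt_1 by (simp only: dvd_mult_cancel_left) simp
    then show False using p_gt_1 dvd_mult_left[of p r 1] by (simp add: zdvd1_eq)
  qed
  ultimately show "(x1 [^]\<^bsub>\<Gamma>\<^esub> nat p) [^]\<^bsub>\<Gamma>\<^esub> nat p \<noteq> \<one>\<^bsub>\<Gamma>\<^esub>"
    by (simp add: one_eq red_eq_iff)
qed

section \<open>Central automorphisms\<close>

text \<open>Multiplication of \<open>u\<close> by a central factor that depends linearly on \<open>u\<close>. The coefficients of \<open>b, c, d\<close> in the
first coordinate carry \<open>q\<close> instead of \<open>p\<close>, because the factors of \<open>x2, x3, x4\<close> must lie in the
derived subgroup, while the factor of \<open>x1\<close> may be any central element.\<close>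

fun central :: "quad \<times> quad \<times> quad \<Rightarrow> quad \<Rightarrow> quad" where
  "central ((s1, s2, s3, s4), (t1, t2, t3, t4), (r1, r2, r3, r4)) (a, b, c, d) =
     (a + p * s1 * a + q * (s2 * b + s3 * c + s4 * d),
      b + p * (t1 * a + t2 * b + t3 * c + t4 * d),
      c + p * (r1 * a + r2 * b + r3 * c + r4 * d), d)"

definition central_aut :: "quad \<times> quad \<times> quad \<Rightarrow> quad \<Rightarrow> quad" where
  "central_aut \<pi> = (\<lambda>u\<in>carrier \<Gamma>. red (central \<pi> u))"

lemma coeffs_cases:
  obtains s1 s2 s3 s4 t1 t2 t3 t4 r1 r2 r3 r4
  where "\<pi> = ((s1, s2, s3, s4), (t1, t2, t3, t4), (r1, r2, r3, r4))"
  by (metis prod_cases4 surj_pair)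

lemma red_central_cong:
  assumes "red u = red u'"
  shows "red (central \<pi> u) = red (central \<pi> u')"
proof -
  obtain s1 s2 s3 s4 t1 t2 t3 t4 r1 r2 r3 r4
    where \<pi>: "\<pi> = ((s1, s2, s3, s4), (t1, t2, t3, t4), (r1, r2, r3, r4))"
    by (rule coeffs_cases)
  obtain a b c d where u: "u = (a, b, c, d)" by (cases u)
  obtain a' b' c' d' where u': "u' = (a', b', c', d')" by (cases u')
  obtain ka kb kc kd
    where k: "a = a' + p * q * ka" "b = b' + p * p * kb" "c = c' + p * p * kc" "d = d' + p * kd"
    using assms unfolding u u' by (rule red_eqE)
  show ?thesis
    unfolding \<pi> u u' central.simps k
    by (rule red_eqI[where ka = "ka * (1 + p * s1) + s2 * p * kb + s3 * p * kc + s4 * kd"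
          and kb = "kb + t1 * q * ka + t2 * p * kb + t3 * p * kc + t4 * kd"
          and kc = "kc + r1 * q * ka + r2 * p * kb + r3 * p * kc + r4 * kd" and kd = kd])
      (simp_all add: algebra_simps)
qed

text \<open>Central factors do not change the cocycle modulo its moduli, and the cocycle values, being in the
derived subgroup, receive no further factor. The witnesses below are the quotients of the
differences of the two sides, with \<open>S\<close>, \<open>T\<close> and \<open>R\<close> abbreviating the linear forms involved.\<close>

lemma red_central_mul: "red (central \<pi> (mul u v)) = red (mul (central \<pi> u) (central \<pi> v))"
proof -
  obtain m where m: "q = p * p * m" by (rule q_eq)
  obtain s1 s2 s3 s4 t1 t2 t3 t4 r1 r2 r3 r4
    where \<pi>: "\<pi> = ((s1, s2, s3, s4), (t1, t2, t3, t4), (r1, r2, r3, r4))"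
    by (rule coeffs_cases)
  obtain a b c d where u: "u = (a, b, c, d)" by (cases u)
  obtain a' b' c' d' where v: "v = (a', b', c', d')" by (cases v)
  define S where "S = s2 * b + s3 * c + s4 * d"
  define T where "T = t1 * a + t2 * b + t3 * c + t4 * d"
  define R where "R = r1 * a' + r2 * b' + r3 * c' + r4 * d'"
  show ?thesis
    unfolding \<pi> u v mul.simps central.simps
    by (rule red_eqI[where ka = "s1 * b * c' + s2 * b * d' + s3 * a * (c' + d') - (b * R + T * c' + p * T * R)"
          and kb = "t1 * p * m * b * c' + t2 * b * d' + t3 * a * (c' + d') - T * d'"
          and kc = "r1 * p * m * b * c' + r2 * b * d' + r3 * a * (c' + d') - a * R -
          (s1 * a + p * m * S) * (c' + p * R + d')" and kd = 0])
      (simp_all add: m S_def T_def R_def algebra_simps)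
qed

text \<open>Composing the two maps gives a sum of both linear forms plus a second-order term. The part
\<open>p^2 s1 s1' a\<close> of that term is symmetric, and every other part is zero in its coordinate because it
contains \<open>p q\<close>, respectively \<open>p p\<close>.\<close>

lemma red_central_commute: "red (central \<pi> (central \<rho> u)) = red (central \<rho> (central \<pi> u))"
proof -
  obtain m where m: "q = p * p * m" by (rule q_eq)
  obtain s1 s2 s3 s4 t1 t2 t3 t4 r1 r2 r3 r4
    where \<pi>: "\<pi> = ((s1, s2, s3, s4), (t1, t2, t3, t4), (r1, r2, r3, r4))"
    by (rule coeffs_cases)
  obtain s1' s2' s3' s4' t1' t2' t3' t4' r1' r2' r3' r4'
    where \<rho>: "\<rho> = ((s1', s2', s3', s4'), (t1', t2', t3', t4'), (r1', r2', r3', r4'))"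
    by (rule coeffs_cases)
  obtain a b c d where u: "u = (a, b, c, d)" by (cases u)
  define S where "S = s2 * b + s3 * c + s4 * d"
  define T where "T = t1 * a + t2 * b + t3 * c + t4 * d"
  define R where "R = r1 * a + r2 * b + r3 * c + r4 * d"
  define S' where "S' = s2' * b + s3' * c + s4' * d"
  define T' where "T' = t1' * a + t2' * b + t3' * c + t4' * d"
  define R' where "R' = r1' * a + r2' * b + r3' * c + r4' * d"
  show ?thesis
    unfolding \<pi> \<rho> u central.simps
    by (rule red_eqI[where ka = "s1 * S' - s1' * S + s2 * T' + s3 * R' - s2' * T - s3' * R"
          and kb = "t1 * (s1' * a + p * m * S') + t2 * T' + t3 * R' -
          (t1' * (s1 * a + p * m * S) + t2' * T + t3' * R)"
          and kc = "r1 * (s1' * a + p * m * S') + r2 * T' + r3 * R' -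
          (r1' * (s1 * a + p * m * S) + r2' * T + r3' * R)" and kd = 0])
      (simp_all add: m S_def T_def R_def S'_def T'_def R'_def algebra_simps)
qed


text \<open>Modulo \<open>p\<close> the map is the identity, so a quadruple in the kernel has all coordinates divisible by
\<open>p\<close>. Then the central factors in the second and third coordinate vanish, and the first coordinate is
multiplied by the unit \<open>1 + p s1\<close>.\<close>

lemma kernel_central:
  assumes "red (central \<pi> u) = red (0, 0, 0, 0)"
  shows "red u = red (0, 0, 0, 0)"
proof -
  obtain m where m: "q = p * p * m" by (rule q_eq)
  obtain s1 s2 s3 s4 t1 t2 t3 t4 r1 r2 r3 r4
    where \<pi>: "\<pi> = ((s1, s2, s3, s4), (t1, t2, t3, t4), (r1, r2, r3, r4))"
    by (rule coeffs_cases)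
  obtain a b c d where u: "u = (a, b, c, d)" by (cases u)
  have A: "p * q dvd a + p * s1 * a + q * (s2 * b + s3 * c + s4 * d)"
    and B: "p * p dvd b + p * (t1 * a + t2 * b + t3 * c + t4 * d)"
    and C: "p * p dvd c + p * (r1 * a + r2 * b + r3 * c + r4 * d)" and d: "p dvd d"
    using assms unfolding u \<pi> central.simps red_eq_iff by simp_all
  have b: "p dvd b" using dvd_mult_left[OF B] by (simp add: dvd_add_left_iff)
  have c: "p dvd c" using dvd_mult_left[OF C] by (simp add: dvd_add_left_iff)
  have "p dvd s2 * b + s3 * c + s4 * d" using b c d by simp
  then have "p * q dvd q * (s2 * b + s3 * c + s4 * d)" by (simp add: mult.commute[of p])
  with A have "p * q dvd a + p * s1 * a" by (simp only: dvd_add_left_iff)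
  then have "p ^ n dvd a * (1 + p * s1)"
    unfolding p_pow_n by (simp add: algebra_simps)
  moreover have "coprime p (1 + p * s1)"
  proof (rule coprimeI)
    fix c assume "c dvd p" "c dvd 1 + p * s1"
    then show "c dvd 1" by (simp add: dvd_add_left_iff)
  qed
  ultimately have "p ^ n dvd a" by (simp add: coprime_dvd_mult_left_iff)
  then have a: "p * q dvd a" by (simp only: p_pow_n)
  then have a': "p dvd a" by (rule dvd_mult_left)
  have "p * p dvd p * (t1 * a + t2 * b + t3 * c + t4 * d)" "p * p dvd p * (r1 * a + r2 * b + r3 * c + r4 * d)"
    using a' b c d by simp_all
  with B C have "p * p dvd b" "p * p dvd c" by (simp_all only: dvd_add_left_iff)
  with a d show ?thesis by (simp add: u red_eq_iff)
qed

lemma central_aut_auto: "central_aut \<pi> \<in> auto \<Gamma>"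
proof -
  have hom: "central_aut \<pi> \<in> hom \<Gamma> \<Gamma>"
  proof (rule homI)
    fix u v assume u: "u \<in> carrier \<Gamma>" and v: "v \<in> carrier \<Gamma>"
    have "red (central \<pi> (red (mul u v))) = red (central \<pi> (mul u v))"
      by (rule red_central_cong) simp
    then show "central_aut \<pi> (u \<otimes>\<^bsub>\<Gamma>\<^esub> v) = central_aut \<pi> u \<otimes>\<^bsub>\<Gamma>\<^esub> central_aut \<pi> v"
      using u v mult_red[of u v]
      by (simp add: central_aut_def mult_red red_id red_central_mul red_closed)
  qed (simp add: central_aut_def red_closed)
  have "inj_on (central_aut \<pi>) (carrier \<Gamma>)"
    unfolding inj_on_one_iff'[OF hom group_\<Gamma> group_\<Gamma>]
  proof (intro allI impI)
    fix u assume "u \<in> carrier \<Gamma>" "central_aut \<pi> u = \<one>\<^bsub>\<Gamma>\<^esub>"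
    then show "u = \<one>\<^bsub>\<Gamma>\<^esub>"
      using kernel_central[of \<pi> u] by (simp add: central_aut_def one_eq red_id)
  qed
  moreover have "finite (carrier \<Gamma>)" by (simp add: \<Gamma>_def)
  moreover have "central_aut \<pi> ` carrier \<Gamma> \<subseteq> carrier \<Gamma>" using hom by (auto simp: hom_def)
  ultimately have "bij_betw (central_aut \<pi>) (carrier \<Gamma>) (carrier \<Gamma>)"
    by (simp add: bij_betw_def endo_inj_surj)
  then show ?thesis using hom by (simp add: auto_def Bij_def central_aut_def)
qed

lemma central_aut_commute:
  "compose (carrier \<Gamma>) (central_aut \<pi>) (central_aut \<rho>) =
   compose (carrier \<Gamma>) (central_aut \<rho>) (central_aut \<pi>)"
proof (rule extensionalityI[of _ "carrier \<Gamma>"])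
  fix u assume "u \<in> carrier \<Gamma>"
  then show "compose (carrier \<Gamma>) (central_aut \<pi>) (central_aut \<rho>) u =
   compose (carrier \<Gamma>) (central_aut \<rho>) (central_aut \<pi>) u"
    using red_central_cong[of "red (central \<rho> u)" "central \<rho> u" \<pi>]
      red_central_cong[of "red (central \<pi> u)" "central \<pi> u" \<rho>] red_central_commute[of \<pi> \<rho> u]
    by (simp add: compose_def central_aut_def red_closed)
qed simp_all

lemma central_aut_x:
  "central_aut ((s1, s2, s3, s4), (t1, t2, t3, t4), (r1, r2, r3, r4)) x1 = red (1 + p * s1, p * t1, p * r1, 0)"
  "central_aut ((s1, s2, s3, s4), (t1, t2, t3, t4), (r1, r2, r3, r4)) x2 = red (q * s2, 1 + p * t2, p * r2, 0)"
  "central_aut ((s1, s2, s3, s4), (t1, t2, t3, t4), (r1, r2, r3, r4)) x3 = red (q * s3, p * t3, 1 + p * r3, 0)"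
  "central_aut ((s1, s2, s3, s4), (t1, t2, t3, t4), (r1, r2, r3, r4)) x4 = red (q * s4, p * t4, p * r4, 1)"
  using red_central_cong[OF red_red] by (simp_all add: central_aut_def x1_def x2_def x3_def x4_def red_closed)

text \<open>A set of representatives of the coefficients: \<open>s1\<close> matters modulo \<open>q\<close>, and all the others
matter modulo \<open>p\<close>.\<close>

definition coeffs :: "(quad \<times> quad \<times> quad) set" where
  "coeffs = ({0..<q} \<times> {0..<p} \<times> {0..<p} \<times> {0..<p}) \<times>
     ({0..<p} \<times> {0..<p} \<times> {0..<p} \<times> {0..<p}) \<times> ({0..<p} \<times> {0..<p} \<times> {0..<p} \<times> {0..<p})"

lemma card_coeffs: "card coeffs = nat p ^ (n + 10)"
proof -
  have "nat q = nat p ^ (n - 1)"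
    using p_gt_1 by (simp add: q_def nat_power_eq)
  then have "card coeffs = nat p ^ (n - 1) * nat p ^ 11"
    by (simp add: coeffs_def card_cartesian_product numeral_eq_Suc)
  also have "\<dots> = nat p ^ (n + 10)" using n3 by (simp add: add.commute flip: power_add)
  finally show ?thesis .
qed

lemma inj_on_central_aut: "inj_on central_aut coeffs"
proof (rule inj_onI)
  fix \<pi> \<rho> assume "\<pi> \<in> coeffs" "\<rho> \<in> coeffs" and eq: "central_aut \<pi> = central_aut \<rho>"
  obtain s1 s2 s3 s4 t1 t2 t3 t4 r1 r2 r3 r4
    where \<pi>: "\<pi> = ((s1, s2, s3, s4), (t1, t2, t3, t4), (r1, r2, r3, r4))"
    by (rule coeffs_cases)
  obtain s1' s2' s3' s4' t1' t2' t3' t4' r1' r2' r3' r4'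
    where \<rho>: "\<rho> = ((s1', s2', s3', s4'), (t1', t2', t3', t4'), (r1', r2', r3', r4'))"
    by (rule coeffs_cases)
  have unique: "x = y" if "M * N dvd M * x - M * y" "0 \<le> x" "x < N" "0 \<le> y" "y < N" "0 < M" for x y M N :: int
  proof -
    have "N dvd x - y" using that by (simp flip: right_diff_distrib)
    then show ?thesis using that by (metis mod_eq_dvd_iff mod_pos_pos_trivial)
  qed
  have r: "0 \<le> s1" "s1 < q" "0 \<le> s1'" "s1' < q"
    "\<forall>x \<in> {s2,s3,s4,t1,t2,t3,t4,r1,r2,r3,r4,s2',s3',s4',t1',t2',t3',t4',r1',r2',r3',r4'}. 0 \<le> x \<and> x < p"
    using \<open>\<pi> \<in> coeffs\<close> \<open>\<rho> \<in> coeffs\<close> by (simp_all add: \<pi> \<rho> coeffs_def)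
  note eqs = arg_cong[OF eq, of "\<lambda>f. f x1"] arg_cong[OF eq, of "\<lambda>f. f x2"]
    arg_cong[OF eq, of "\<lambda>f. f x3"] arg_cong[OF eq, of "\<lambda>f. f x4"]
  have D: "p * q dvd p * s1 - p * s1'" "q * p dvd q * s2 - q * s2'" "q * p dvd q * s3 - q * s3'"
    "q * p dvd q * s4 - q * s4'"
    "p * p dvd p * t1 - p * t1'" "p * p dvd p * t2 - p * t2'" "p * p dvd p * t3 - p * t3'" "p * p dvd p * t4 - p * t4'"
    "p * p dvd p * r1 - p * r1'" "p * p dvd p * r2 - p * r2'" "p * p dvd p * r3 - p * r3'" "p * p dvd p * r4 - p * r4'"
    using eqs by (simp_all add: \<pi> \<rho> central_aut_x red_eq_iff mult.commute[of p q])
  have "s1 = s1'" "s2 = s2'" "s3 = s3'" "s4 = s4'" "t1 = t1'" "t2 = t2'" "t3 = t3'" "t4 = t4'"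
    "r1 = r1'" "r2 = r2'" "r3 = r3'" "r4 = r4'"
    by (rule D[THEN unique]; use r p_gt_1 q_pos in simp)+
  then show "\<pi> = \<rho>" by (simp add: \<pi> \<rho>)
qed

section \<open>Every automorphism is central\<close>

text \<open>Translates a commutator relation \<open>[u,v] = w^k\<close> into congruences. Since \<open>p\<close> divides \<open>k\<close>, the element
\<open>w^k\<close> is central and its coordinates are \<open>k\<close> times those of \<open>w\<close>; taking \<open>k = 0\<close> covers commuting pairs.\<close>

lemma commute_up_to_power_iff:
  assumes "p dvd int k"
  shows "red (a, b, c, d) \<otimes>\<^bsub>\<Gamma>\<^esub> red (a', b', c', d') =
      red (a', b', c', d') \<otimes>\<^bsub>\<Gamma>\<^esub> red (a, b, c, d) \<otimes>\<^bsub>\<Gamma>\<^esub> (red (e, f, g, h) [^]\<^bsub>\<Gamma>\<^esub> k) \<longleftrightarrow>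
    p * q dvd q * (b * c' - b' * c) - int k * e \<and>
    p * p dvd p * (b * d' - b' * d) - int k * f \<and>
    p * p dvd p * (a * (c' + d') - a' * (c + d)) - int k * g"
proof -
  obtain m where k: "int k = p * m" using assms by (elim dvdE)
  have shift: "w dvd x \<longleftrightarrow> w dvd y" if "x = y - w * z" for w x y z :: int
    unfolding that by (simp add: dvd_diff_left_iff)
  have "p * q dvd a + a' + q * b * c' - (a' + a + q * b' * c + p * m * e + q * (b' + b + p * b' * d) * (p * m * g)) \<longleftrightarrow>
      p * q dvd q * (b * c' - b' * c) - p * m * e"
    by (rule shift[where z = "(b' + b + p * b' * d) * (m * g)"]) (simp add: algebra_simps)
  moreover have "p * p dvd c + c' + p * a * (c' + d') -
       (c' + c + p * a' * (c + d) + p * m * g + p * (a' + a + q * b' * c) * (p * m * g)) \<longleftrightarrow>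
      p * p dvd p * (a * (c' + d') - a' * (c + d)) - p * m * g"
    by (rule shift[where z = "(a' + a + q * b' * c) * (m * g)"]) (simp add: algebra_simps)
  ultimately show ?thesis
    unfolding pow_red_multiple[OF assms] mult_red mul.simps red_eq_iff k
    by (simp add: algebra_simps)
qed

text \<open>Each of the six commutator relations between generators is applied to the images and read off in
coordinates. Two consequences of bijectivity enter: the image of \<open>x4\<close> has order \<open>p\<close>, while the images
of \<open>x2\<close> and \<open>x3\<close> do not. This leaves \<open>b2\<close> and \<open>c3\<close> as units modulo \<open>p\<close>, by which the other
congruences can be divided.\<close>

lemma auto_congruences:
  assumes \<phi>: "\<phi> \<in> auto \<Gamma>"
    and x: "\<phi> x1 = (a1, b1, c1, d1)" "\<phi> x2 = (a2, b2, c2, d2)"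
      "\<phi> x3 = (a3, b3, c3, d3)" "\<phi> x4 = (a4, b4, c4, d4)"
  shows "p dvd a1 - 1" "p dvd b1" "p dvd c1" "p dvd d1"
    "q dvd a2" "p dvd b2 - 1" "p dvd c2" "p dvd d2"
    "q dvd a3" "p dvd b3" "p dvd c3 - 1" "p dvd d3"
    "q dvd a4" "p dvd b4" "p dvd c4" "p dvd d4 - 1"
proof -
  obtain m where m: "q = p * p * m" by (rule q_eq)
  have p_q: "p dvd q" by (simp add: m)
  have p0: "p \<noteq> 0" and q0: "q \<noteq> 0" using p_gt_1 q_pos by simp_all
  have P: "p dvd int (nat p)" "p dvd int 0" "p dvd int (nat q)" using p_gt_1 q_pos p_q by simp_all
  have prime: "p dvd x * y \<longleftrightarrow> p dvd x \<or> p dvd y" for x y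
    using prime_dvd_mult_iff[of p x y] prime_p by simp
  interpret \<phi>: group_hom \<Gamma> \<Gamma> \<phi>
    using \<phi> by unfold_locales (simp add: auto_def)
  have red: "\<phi> x1 = red (a1, b1, c1, d1)" "\<phi> x2 = red (a2, b2, c2, d2)"
      "\<phi> x3 = red (a3, b3, c3, d3)" "\<phi> x4 = red (a4, b4, c4, d4)"
    using red_id[OF \<phi>.hom_closed] x x_closed by metis+
  have rel: "\<phi> x \<otimes>\<^bsub>\<Gamma>\<^esub> \<phi> y = \<phi> y \<otimes>\<^bsub>\<Gamma>\<^esub> \<phi> x \<otimes>\<^bsub>\<Gamma>\<^esub> (\<phi> z [^]\<^bsub>\<Gamma>\<^esub> k)"
    if "x \<otimes>\<^bsub>\<Gamma>\<^esub> y = y \<otimes>\<^bsub>\<Gamma>\<^esub> x \<otimes>\<^bsub>\<Gamma>\<^esub> (z [^]\<^bsub>\<Gamma>\<^esub> k)"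
      "x \<in> carrier \<Gamma>" "y \<in> carrier \<Gamma>" "z \<in> carrier \<Gamma>" for x y z and k :: nat
    using arg_cong[OF that(1), of \<phi>] that(2-4) by (simp add: \<phi>.hom_nat_pow)
  have "x2 \<otimes>\<^bsub>\<Gamma>\<^esub> x4 = x4 \<otimes>\<^bsub>\<Gamma>\<^esub> x2 \<otimes>\<^bsub>\<Gamma>\<^esub> (x2 [^]\<^bsub>\<Gamma>\<^esub> nat p)"
    unfolding x1_def x2_def x3_def x4_def commute_up_to_power_iff[OF P(1)] using p_gt_1 by simp
  from rel[OF this]
  have R24: "p * q dvd q * (b2 * c4 - b4 * c2) - p * a2"
      "p dvd b2 * d4 - b4 * d2 - b2" "p dvd a2 * (c4 + d4) - a4 * (c2 + d2) - c2"
    unfolding red commute_up_to_power_iff[OF P(1)] using p_gt_1 by (simp_all flip: right_diff_distrib)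
  have "x3 \<otimes>\<^bsub>\<Gamma>\<^esub> x4 = x4 \<otimes>\<^bsub>\<Gamma>\<^esub> x3 \<otimes>\<^bsub>\<Gamma>\<^esub> (x1 [^]\<^bsub>\<Gamma>\<^esub> (0::nat))"
    unfolding x1_def x2_def x3_def x4_def commute_up_to_power_iff[OF P(2)] by simp
  from rel[OF this]
  have R34: "p dvd b3 * d4 - b4 * d3"
    unfolding red commute_up_to_power_iff[OF P(2)] using p_gt_1 by simp
  have "x1 \<otimes>\<^bsub>\<Gamma>\<^esub> x4 = x4 \<otimes>\<^bsub>\<Gamma>\<^esub> x1 \<otimes>\<^bsub>\<Gamma>\<^esub> (x3 [^]\<^bsub>\<Gamma>\<^esub> nat p)"
    unfolding x1_def x2_def x3_def x4_def commute_up_to_power_iff[OF P(1)] using p_gt_1 by simp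
  from rel[OF this]
  have R14: "p * q dvd q * (b1 * c4 - b4 * c1) - p * a3"
      "p dvd b1 * d4 - b4 * d1 - b3" "p dvd a1 * (c4 + d4) - a4 * (c1 + d1) - c3"
    unfolding red commute_up_to_power_iff[OF P(1)] using p_gt_1 by (simp_all flip: right_diff_distrib)
  have "x1 \<otimes>\<^bsub>\<Gamma>\<^esub> x3 = x3 \<otimes>\<^bsub>\<Gamma>\<^esub> x1 \<otimes>\<^bsub>\<Gamma>\<^esub> (x3 [^]\<^bsub>\<Gamma>\<^esub> nat p)"
    unfolding x1_def x2_def x3_def x4_def commute_up_to_power_iff[OF P(1)] using p_gt_1 by simp
  from rel[OF this]
  have R13: "p dvd a1 * (c3 + d3) - a3 * (c1 + d1) - c3"
    unfolding red commute_up_to_power_iff[OF P(1)] using p_gt_1 by (simp_all flip: right_diff_distrib)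
  have "x2 \<otimes>\<^bsub>\<Gamma>\<^esub> x3 = x3 \<otimes>\<^bsub>\<Gamma>\<^esub> x2 \<otimes>\<^bsub>\<Gamma>\<^esub> (x1 [^]\<^bsub>\<Gamma>\<^esub> nat q)"
    unfolding x1_def x2_def x3_def x4_def commute_up_to_power_iff[OF P(3)] using q_pos by simp
  from rel[OF this]
  have "q * p dvd q * (b2 * c3 - b3 * c2 - a1)" "p * p dvd p * (b2 * d3 - b3 * d2) - p * (p * (m * b1))"
    unfolding red commute_up_to_power_iff[OF P(3)] using q_pos
    by (simp_all add: right_diff_distrib mult.commute[of p q]) (simp_all add: m mult.assoc)
  then have R23: "p dvd b2 * c3 - b3 * c2 - a1" "p dvd b2 * d3 - b3 * d2"
    using p0 q0 by (simp_all add: dvd_diff_left_iff flip: right_diff_distrib)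
  have "x1 \<otimes>\<^bsub>\<Gamma>\<^esub> x2 = x2 \<otimes>\<^bsub>\<Gamma>\<^esub> x1 \<otimes>\<^bsub>\<Gamma>\<^esub> (x1 [^]\<^bsub>\<Gamma>\<^esub> (0::nat))"
    unfolding x1_def x2_def x3_def x4_def commute_up_to_power_iff[OF P(2)] by simp
  from rel[OF this]
  have R12: "q * p dvd q * (b1 * c2 - b2 * c1)" "p dvd b1 * d2 - b2 * d1" "p dvd a1 * (c2 + d2) - a2 * (c1 + d1)"
    unfolding red commute_up_to_power_iff[OF P(2)] using p_gt_1 by (simp_all add: mult.commute[of q p])
  have pow_p: "red (a, b, c, d) [^]\<^bsub>\<Gamma>\<^esub> nat p = \<one>\<^bsub>\<Gamma>\<^esub> \<longleftrightarrow> q dvd a \<and> p dvd b \<and> p dvd c" for a b c d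
    unfolding pow_red_multiple[OF P(1)] one_eq red_eq_iff using p_gt_1 by simp
  have inj: "\<phi> x [^]\<^bsub>\<Gamma>\<^esub> nat p = \<one>\<^bsub>\<Gamma>\<^esub> \<longleftrightarrow> x [^]\<^bsub>\<Gamma>\<^esub> nat p = \<one>\<^bsub>\<Gamma>\<^esub>" if "x \<in> carrier \<Gamma>" for x
    using iso_pow_eq_one_iff[OF group_\<Gamma> group_\<Gamma> _ that] \<phi> by (simp add: auto_def iso_def Bij_def)
  have "q dvd a4 \<and> p dvd b4 \<and> p dvd c4"
    using inj[OF x_closed(4)] unfolding red pow_p unfolding x4_def pow_p by simp
  then show 4: "q dvd a4" "p dvd b4" "p dvd c4" by simp_all
  \<comment> \<open>The image of \<open>x4\<close> is now a central element times a power of \<open>x4\<close>, so its commutators lose all cocycle terms except those in \<open>d4\<close>.\<close>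
  then have a4: "p dvd a4" using p_q by auto
  have 22: "p * q dvd q * (b2 * c4 - b4 * c2)" "p * q dvd q * (b1 * c4 - b4 * c1)"
    using 4 by (simp_all add: mult.commute[of p q])
  show a2: "q dvd a2" using R24(1) 22(1) p0 by (simp add: dvd_diff_right_iff)
  show a3: "q dvd a3" using R14(1) 22(2) p0 by (simp add: dvd_diff_right_iff)
  have a23: "p dvd a2" "p dvd a3" using a2 a3 p_q by auto
  show c2: "p dvd c2" using R24(3) a4 a23 by (simp add: dvd_diff_right_iff)
  have "\<not> (q dvd a2 \<and> p dvd b2 \<and> p dvd c2)"
    using inj[OF x_closed(2)] p_gt_1 unfolding red pow_p unfolding x2_def pow_p by simp
  then have b2: "\<not> p dvd b2" using a2 c2 by simp
  \<comment> \<open>Relation \<open>[x2,x4] = x2^p\<close>: the scalar \<open>b2\<close> cancels and \<open>d4\<close> must be 1.\<close>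
  have "p dvd b2 * (d4 - 1)"
    using dvd_add[OF R24(2) dvd_mult2[OF 4(2), of d2]] by (simp add: algebra_simps)
  then show d4: "p dvd d4 - 1" using b2 prime by simp
  have d4': "\<not> p dvd d4"
    using d4 p_gt_1 by (metis dvd_diff_right_iff dvd_refl prime_p not_prime_unit)
  have "p dvd b3 * d4"
    using dvd_add[OF R34 dvd_mult2[OF 4(2), of d3]] by (simp add: algebra_simps)
  then show b3: "p dvd b3" using d4' prime by simp
  have "\<not> (q dvd a3 \<and> p dvd b3 \<and> p dvd c3)"
    using inj[OF x_closed(3)] p_gt_1 unfolding red pow_p unfolding x3_def pow_p by simp
  then have c3: "\<not> p dvd c3" using a3 b3 by simp
  have "p dvd b1 * d4"
    using dvd_add[OF dvd_add[OF R14(2) dvd_mult2[OF 4(2), of d1]] b3] by (simp add: algebra_simps)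
  then show b1: "p dvd b1" using d4' prime by simp
  \<comment> \<open>Relation \<open>[x1,x4] = x3^p\<close> gives \<open>a1 = c3\<close>. With \<open>[x2,x3] = x1^q\<close>, that is \<open>b2 c3 = a1\<close>, it yields \<open>b2 = 1\<close>.\<close>
  have a1_c3: "p dvd a1 - c3"
    using dvd_diff[OF dvd_diff[OF dvd_add[OF R14(3) dvd_mult2[OF a4, of "c1 + d1"]] dvd_mult[OF 4(3), of a1]]
        dvd_mult[OF d4, of a1]] by (simp add: algebra_simps)
  have "p dvd (b2 - 1) * c3"
    using dvd_add[OF dvd_add[OF R23(1) dvd_mult2[OF b3, of c2]] a1_c3] by (simp add: algebra_simps)
  then show "p dvd b2 - 1" using c3 prime by simp
  have "p dvd b2 * d3"
    using dvd_add[OF R23(2) dvd_mult2[OF b3, of d2]] by (simp add: algebra_simps)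
  then show d3: "p dvd d3" using b2 prime by simp
  \<comment> \<open>Relation \<open>[x1,x3] = x3^p\<close> gives \<open>a1 c3 = c3\<close>.\<close>
  have "p dvd (a1 - 1) * c3"
    using dvd_diff[OF dvd_add[OF R13 dvd_mult2[OF a23(2), of "c1 + d1"]] dvd_mult[OF d3, of a1]]
    by (simp add: algebra_simps)
  then show a1: "p dvd a1 - 1" using c3 prime by simp
  show "p dvd c3 - 1" using dvd_diff[OF a1 a1_c3] by simp
  have a1': "\<not> p dvd a1"
    using a1 by (metis dvd_diff_right_iff dvd_refl prime_p not_prime_unit)
  \<comment> \<open>The commuting pair \<open>x1, x2\<close> kills the remaining entries \<open>c1\<close>, \<open>d1\<close> and \<open>d2\<close>.\<close>
  have "p dvd b1 * c2 - b2 * c1" using R12(1) q0 by simp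
  from dvd_diff[OF this dvd_mult2[OF b1, of c2]] show "p dvd c1" using b2 prime by simp
  from dvd_diff[OF R12(2) dvd_mult2[OF b1, of d2]] show "p dvd d1" using b2 prime by simp
  have "p dvd a1 * d2"
    using dvd_diff[OF dvd_add[OF R12(3) dvd_mult2[OF a23(1), of "c1 + d1"]] dvd_mult[OF c2, of a1]]
    by (simp add: algebra_simps)
  then show "p dvd d2" using a1' prime by simp
qed

text \<open>Given the congruences, the coefficients of an automorphism are obtained by dividing the coordinates
of the images of the generators; a homomorphism is determined by these images.\<close>

lemma auto_eq_central: "auto \<Gamma> = central_aut ` coeffs"
proof
  show "central_aut ` coeffs \<subseteq> auto \<Gamma>" using central_aut_auto by blast
  show "auto \<Gamma> \<subseteq> central_aut ` coeffs"
  proof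
    fix \<phi> assume \<phi>: "\<phi> \<in> auto \<Gamma>"
    then have hom: "\<phi> \<in> hom \<Gamma> \<Gamma>" and ext: "\<phi> \<in> extensional (carrier \<Gamma>)"
      by (auto simp: auto_def Bij_def)
    obtain a1 b1 c1 d1 where x1: "\<phi> x1 = (a1, b1, c1, d1)" by (cases "\<phi> x1")
    obtain a2 b2 c2 d2 where x2: "\<phi> x2 = (a2, b2, c2, d2)" by (cases "\<phi> x2")
    obtain a3 b3 c3 d3 where x3: "\<phi> x3 = (a3, b3, c3, d3)" by (cases "\<phi> x3")
    obtain a4 b4 c4 d4 where x4: "\<phi> x4 = (a4, b4, c4, d4)" by (cases "\<phi> x4")
    have closed: "\<phi> x \<in> carrier \<Gamma>" if "x \<in> carrier \<Gamma>" for x using hom that by (auto simp: hom_def)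
    have range: "(a1, b1, c1, d1) \<in> carrier \<Gamma>" "(a2, b2, c2, d2) \<in> carrier \<Gamma>"
      "(a3, b3, c3, d3) \<in> carrier \<Gamma>" "(a4, b4, c4, d4) \<in> carrier \<Gamma>"
      using closed[OF x_closed(1)] closed[OF x_closed(2)] closed[OF x_closed(3)] closed[OF x_closed(4)]
      by (simp_all add: x1 x2 x3 x4)
    note cong = auto_congruences[OF \<phi> x1 x2 x3 x4]
    have zero: "d = 0" if "p dvd d" "0 \<le> d" "d < p" for d
      using that zdvd_not_zless[of d p] by fastforce
    have d: "d1 = 0" "d2 = 0" "d3 = 0"
      using cong range by (auto intro!: zero simp: \<Gamma>_def)
    have "d4 \<noteq> 0" using cong(16) p_gt_1 by auto
    then have "d4 - 1 = 0"
      using cong(16) range(4) by (intro zero) (auto simp: \<Gamma>_def)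
    then have d4: "d4 = 1" by simp
    define \<pi> where "\<pi> =
      (((a1 - 1) div p, a2 div q, a3 div q, a4 div q),
       (b1 div p, (b2 - 1) div p, b3 div p, b4 div p),
       (c1 div p, c2 div p, (c3 - 1) div p, c4 div p))"
    \<comment> \<open>The lower bound \<open>- N\<close> instead of 0 admits the numerators \<open>a1 - 1\<close>, \<open>b2 - 1\<close> and \<open>c3 - 1\<close>, which are only bounded below by \<open>- 1\<close>.\<close>
    have quot: "0 \<le> x div N \<and> x div N < M" if N: "N dvd x" "- N < x" "x < N * M" "0 < N" for x N M :: int
    proof -
      obtain k where k: "x = N * k" using N(1) by (elim dvdE)
      have "N * (- 1) < N * k" using N k by simp
      then have "- 1 < k" using N(4) mult_less_cancel_left_pos by blast
      moreover have "k < M" using N k by simp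
      ultimately show ?thesis using k N(4) by simp
    qed
    have bounds: "0 \<le> a1" "a1 < p * q" "0 \<le> a2" "a2 < p * q" "0 \<le> a3" "a3 < p * q" "0 \<le> a4" "a4 < p * q"
      "0 \<le> b1" "b1 < p * p" "0 \<le> b2" "b2 < p * p" "0 \<le> b3" "b3 < p * p" "0 \<le> b4" "b4 < p * p"
      "0 \<le> c1" "c1 < p * p" "0 \<le> c2" "c2 < p * p" "0 \<le> c3" "c3 < p * p" "0 \<le> c4" "c4 < p * p"
      using range by (simp_all add: \<Gamma>_def)
    have quot_p: "0 \<le> x div p \<and> x div p < M" if "p dvd x" "- 1 \<le> x" "x < p * M" for x M
      using quot[of p x M] that p_gt_1 by simp
    have quot_q: "0 \<le> x div q \<and> x div q < p" if "q dvd x" "0 \<le> x" "x < p * q" for x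
      using quot[of q x p] that q_pos by (simp add: mult.commute)
    have "0 \<le> (a1 - 1) div p \<and> (a1 - 1) div p < q"
      by (rule quot_p[OF cong(1)]) (use bounds in simp_all)
    moreover have "0 \<le> a2 div q \<and> a2 div q < p" "0 \<le> a3 div q \<and> a3 div q < p" "0 \<le> a4 div q \<and> a4 div q < p"
      by (rule quot_q; use bounds cong in simp)+
    moreover have "0 \<le> b1 div p \<and> b1 div p < p" "0 \<le> (b2 - 1) div p \<and> (b2 - 1) div p < p"
      "0 \<le> b3 div p \<and> b3 div p < p" "0 \<le> b4 div p \<and> b4 div p < p"
      "0 \<le> c1 div p \<and> c1 div p < p" "0 \<le> c2 div p \<and> c2 div p < p"
      "0 \<le> (c3 - 1) div p \<and> (c3 - 1) div p < p" "0 \<le> c4 div p \<and> c4 div p < p"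
      by (rule quot_p; use bounds cong in simp)+
    ultimately have "\<pi> \<in> coeffs" unfolding \<pi>_def coeffs_def mem_Sigma_iff atLeastLessThan_iff by blast
    moreover have "\<phi> = central_aut \<pi>"
    proof (rule extensionalityI[OF ext])
      show "central_aut \<pi> \<in> extensional (carrier \<Gamma>)" by (simp add: central_aut_def)
      have "central_aut \<pi> \<in> hom \<Gamma> \<Gamma>" using central_aut_auto by (simp add: auto_def)
      moreover have "\<phi> x1 = central_aut \<pi> x1" "\<phi> x2 = central_aut \<pi> x2"
          "\<phi> x3 = central_aut \<pi> x3" "\<phi> x4 = central_aut \<pi> x4"
        using cong range[THEN red_id] by (simp_all add: \<pi>_def central_aut_x x1 x2 x3 x4 d d4)
      ultimately show "\<phi> u = central_aut \<pi> u" if "u \<in> carrier \<Gamma>" for u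
        using hom_eqI[OF group_\<Gamma> hom] that by blast
    qed
    ultimately show "\<phi> \<in> central_aut ` coeffs" by blast
  qed
qed

lemma order_AutoGroup_\<Gamma>: "order (AutoGroup \<Gamma>) = nat p ^ (n + 10)"
  using card_image[OF inj_on_central_aut]
  by (simp add: order_def AutoGroup_simps auto_eq_central card_coeffs)

lemma comm_group_AutoGroup_\<Gamma>: "comm_group (AutoGroup \<Gamma>)"
proof (rule group.group_comm_groupI[OF \<Gamma>.AutoGroup])
  fix \<phi> \<psi> assume "\<phi> \<in> carrier (AutoGroup \<Gamma>)" "\<psi> \<in> carrier (AutoGroup \<Gamma>)"
  then show "\<phi> \<otimes>\<^bsub>AutoGroup \<Gamma>\<^esub> \<psi> = \<psi> \<otimes>\<^bsub>AutoGroup \<Gamma>\<^esub> \<phi>"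
    using central_aut_commute by (auto simp: AutoGroup_simps) (auto simp: auto_eq_central)
qed

end

section \<open>The existence theorem\<close>

theorem theoremA:
  fixes p n m :: nat
  assumes "Factorial_Ring.prime p" and "odd p" and "n \<ge> 3" and "m = n + 5"
  shows "\<exists>G :: nat monoid. group G \<and> d_generated 4 G \<and> order G = p ^ m \<and>
           group_exponent G = p ^ n \<and> comm_group (AutoGroup G) \<and>
           \<not> special_p_group p G \<and> order (AutoGroup G) = p ^ (n + 10)"
proof -
  interpret odd_prime_ge3 "int p" n
    using assms by unfold_locales auto
  have "finite (carrier \<Gamma>)" by (simp add: \<Gamma>_def)
  then obtain G :: "nat monoid" and f where G: "group G" and f: "f \<in> iso \<Gamma> G"
    using exists_iso_nat_group[OF group_\<Gamma>] by blast
  interpret G: group G by fact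
  have "order G = p ^ m"
    using iso_same_card[OF is_isoI[OF f]] order_\<Gamma> assms(4) by (simp add: order_def)
  moreover have "d_generated 4 G"
    using iso_d_generated[OF group_\<Gamma> G f d_generated_\<Gamma>] .
  moreover have "group_exponent G = p ^ n"
    using iso_group_exponent[OF group_\<Gamma> G f] group_exponent_\<Gamma> by simp
  moreover have iso: "AutoGroup \<Gamma> \<cong> AutoGroup G"
    using iso_AutoGroup[OF group_\<Gamma> G f] .
  then have "comm_group (AutoGroup G)"
    using comm_group.iso_imp_comm_group[OF comm_group_AutoGroup_\<Gamma>] G.AutoGroup group.is_monoid by blast
  moreover have "order (AutoGroup G) = p ^ (n + 10)"
    using iso_same_card[OF iso] order_AutoGroup_\<Gamma> by (simp add: order_def)
  moreover have "\<not> special_p_group p G"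
    using G.not_special_p_group[OF iso_image_center[OF group_\<Gamma> G f x1_pow_p(1)]] x1_pow_p(2)
      iso_pow_eq_one_iff[OF group_\<Gamma> G f \<Gamma>.nat_pow_closed[OF x_closed(1)]] by simp
  ultimately show ?thesis using G by blast
qed

end
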